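(* For any $\alpha\in(0,\frac12]$ and any integers $p\ge q\ge d+1$ (with $d\ge 1$) there exist a finite constant $C=C(p,q,d)<\infty$, depending only on $p,q,d$, and a constant $\beta=\beta(\alpha,d)\in(0,\alpha)$, depending only on $\alpha$ and $d$, such that the following holds: every family $\mathcal{P}=\{P_1,\dots,P_n\}$ of $n\ge p$ finite point sets in $\mathbb{R}^d$ that has the $(p,q,\alpha)$-property with respect to hyperplanes can be $\beta$-split by a set $Q$ of at most $C$ hyperplanes.
   Context: Let $\gamma\in(0,\frac12]$. A finite point set $P\subset\mathbb{R}^d$ is $\gamma$-split by a hyperplane $h$ if each of the two closed half-spaces bounded by $h$ contains at least $\gamma|P|$ points of $P$. A family $\mathcal{P}=\{P_1,\dots,P_n\}$ of finite point sets in $\mathbb{R}^d$ has the $(p,q,\alpha)$-property with respect to hyperplanes if among any $p$ members of $\mathcal{P}$ there are some $q$ that are all simultaneously $\alpha$-split by one and the same hyperplane. The family $\mathcal{P}$ is $\beta$-split by a set $Q$ of hyperplanes if each $P_i\in\mathcal{P}$ is $\beta$-split by at least one element of $Q$. *)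

theory Defs
  imports "HOL-Analysis.Analysis"
begin

definition hyperplane :: "'a::euclidean_space set \<Rightarrow> bool" where
  "hyperplane h \<longleftrightarrow> (\<exists>a b. a \<noteq> 0 \<and> h = {x. a \<bullet> x = b})"

(* Both sides of h occur here: the pair (- a, - b) describes the same hyperplane
   as (a, b) and yields the opposite half-space. *)
definition closed_halfspaces :: "'a::euclidean_space set \<Rightarrow> 'a set set" where
  "closed_halfspaces h =
     {H. \<exists>a b. a \<noteq> 0 \<and> h = {x. a \<bullet> x = b} \<and> H = {x. a \<bullet> x \<le> b}}"

definition split_by :: "real \<Rightarrow> 'a::euclidean_space set \<Rightarrow> 'a set \<Rightarrow> bool" where
  "split_by \<gamma> P h \<longleftrightarrow> hyperplane h \<and>
     (\<forall>H\<in>closed_halfspaces h. real (card (P \<inter> H)) \<ge> \<gamma> * real (card P))"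

(* The family is indexed by I, so "p members" means p distinct indices and
   repeated point sets are allowed. *)
definition pq_property ::
    "nat \<Rightarrow> nat \<Rightarrow> real \<Rightarrow> 'i set \<Rightarrow> ('i \<Rightarrow> 'a::euclidean_space set) \<Rightarrow> bool" where
  "pq_property p q \<alpha> I P \<longleftrightarrow>
     (\<forall>J\<subseteq>I. card J = p \<longrightarrow>
        (\<exists>K\<subseteq>J. card K = q \<and> (\<exists>h. hyperplane h \<and> (\<forall>i\<in>K. split_by \<alpha> (P i) h))))"

definition family_split_by ::
    "real \<Rightarrow> 'i set \<Rightarrow> ('i \<Rightarrow> 'a::euclidean_space set) \<Rightarrow> 'a set set \<Rightarrow> bool" where
  "family_split_by \<beta> I P Q \<longleftrightarrow> (\<forall>i\<in>I. \<exists>h\<in>Q. split_by \<beta> (P i) h)"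

end

theory Submission
  imports Defs
begin

text \<open>
  The points of depth at least \<open>\<beta> |P|\<close>, with \<open>\<beta> = \<alpha> / (d + 1)\<close>, form a nonempty convex set; every hyperplane
  meeting it \<open>\<beta>\<close>-splits \<open>P\<close>, and every hyperplane that \<open>\<alpha>\<close>-splits \<open>P\<close> meets it, since it separates centerpoints
  of the two parts of \<open>P\<close>. It remains to pierce a family of convex sets with few hyperplanes when
  among any \<open>p\<close> of them some \<open>d + 1\<close> have a common hyperplane transversal.

  The piercing number \<open>\<tau>\<close> of subfamilies is subadditive, and the centerpoint theorem holds for any
  subadditive set function in place of cardinality. If \<open>\<tau>\<close> of the whole family is huge, start with \<open>p\<close>
  copies of it. For each choice of \<open>d + 1\<close> copies, a hyperplane through \<open>\<tau>\<close>-centerpoints of \<open>d\<close> of them leaves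
  subfamilies of large \<open>\<tau>\<close> strictly on both sides of these \<open>d\<close>, and on at least one side of the last one; the sets that
  it meets only cost \<open>1\<close>. So the copies can be shrunk until any \<open>d + 1\<close> of them are strictly separated by
  hyperplanes according to every sign pattern, while \<open>\<tau>\<close> stays positive. By Radon's theorem, picking one
  set from each copy gives \<open>p\<close> sets no \<open>d + 1\<close> of which have a hyperplane transversal.
\<close>

section \<open>Centerpoints for subadditive set functions\<close>

text \<open>Helly's theorem gives a common point \<open>c\<close> of the hulls of all
  \<open>G\<close> whose complement has \<open>\<tau>\<close> below
  \<open>\<tau> S / (d + 1)\<close>: by subadditivity, d + 1 such complements cannot cover
  \<open>S\<close>, so d + 1 such \<open>G\<close> share an index. A half-space violating the bound
  would cut out such a complement, leaving \<open>c\<close> in a hull on the opposite open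
  side.\<close>

lemma subadditive_centerpoint:
  fixes x :: "'i \<Rightarrow> 'a::euclidean_space" and \<tau> :: "'i set \<Rightarrow> nat"
  assumes S: "finite S" and empty: "\<tau> {} = 0"
    and subadd: "\<And>A B. A \<subseteq> S \<Longrightarrow> B \<subseteq> S \<Longrightarrow> \<tau> (A \<union> B) \<le> \<tau> A + \<tau> B"
  obtains c where "\<And>a b. a \<bullet> c \<le> b \<Longrightarrow> \<tau> S \<le> (DIM('a) + 1) * \<tau> {i \<in> S. a \<bullet> x i \<le> b}"
proof -
  let ?D = "DIM('a) + 1"
  define \<G> where "\<G> = {G. G \<subseteq> S \<and> ?D * \<tau> (S - G) < \<tau> S}"
  define f where "f = (\<lambda>G. convex hull (x ` G)) ` \<G>"
  have "finite \<G>"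
    by (rule finite_subset[of _ "Pow S"]) (use S in \<open>auto simp: \<G>_def\<close>)
  then have "finite f"
    by (simp add: f_def)
  have UN: "\<tau> (\<Union>G\<in>\<H>. S - G) \<le> (\<Sum>G\<in>\<H>. \<tau> (S - G))" if "finite \<H>" for \<H> :: "'i set set"
    using that
  proof (induction rule: finite_induct)
    case (insert G \<H>)
    have "\<tau> ((S - G) \<union> (\<Union>G\<in>\<H>. S - G)) \<le> \<tau> (S - G) + \<tau> (\<Union>G\<in>\<H>. S - G)"
      by (rule subadd) auto
    with insert show ?case by simp
  qed (simp add: empty)
  have small: "\<Inter>t \<noteq> {}" if t: "t \<subseteq> f" "card t \<le> ?D" for t
  proof -
    \<comment> \<open>Different \<open>G\<close> may have equal hulls, so one \<open>G\<close> is
      chosen per hull; then the bound on \<open>card t\<close> also bounds the number of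
      complements.\<close>
    obtain \<H> where \<H>: "\<H> \<subseteq> \<G>" "inj_on (\<lambda>G. convex hull (x ` G)) \<H>" "t = (\<lambda>G. convex hull (x ` G)) ` \<H>"
      using t(1) unfolding f_def subset_image_inj by blast
    have fin: "finite \<H>"
      using \<H>(1) \<open>finite \<G>\<close> finite_subset by blast
    have card: "card \<H> \<le> ?D"
      using t(2) \<H> by (simp add: card_image)
    show ?thesis
    \<comment> \<open>The strict inequality between the sums below needs a summand; for empty
      \<open>\<H>\<close> the intersection is the whole space.\<close>
    proof (cases "\<H> = {}")
      case True
      then show ?thesis using \<H>(3) by simp
    next
      case False
      have "?D * \<tau> (\<Union>G\<in>\<H>. S - G) \<le> (\<Sum>G\<in>\<H>. ?D * \<tau> (S - G))"
        using mult_le_mono2[OF UN[OF fin], of ?D] by (simp only: sum_distrib_left)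
      also have "\<dots> < (\<Sum>G\<in>\<H>. \<tau> S)"
        by (rule sum_strict_mono) (use fin False \<H>(1) in \<open>auto simp: \<G>_def\<close>)
      also have "\<dots> \<le> ?D * \<tau> S"
        using mult_le_mono1[OF card, of "\<tau> S"] by simp
      finally have "(\<Union>G\<in>\<H>. S - G) \<noteq> S"
        by auto
      then obtain i where "i \<in> S" "\<forall>G\<in>\<H>. i \<in> G"
        by blast
      then have "x i \<in> \<Inter>t"
        unfolding \<H>(3) by (auto intro: hull_inc)
      then show ?thesis by blast
    qed
  qed
  have "\<Inter>f \<noteq> {}"
  proof (cases "card f \<le> ?D")
    case True
    then show ?thesis by (rule small[OF subset_refl])
  next
    case False
    show ?thesis
    proof (rule Helly)
      show "?D \<le> card f"
        using False by simp
      show "\<forall>s\<in>f. convex s"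
        by (simp add: f_def)
      show "\<Inter>t \<noteq> {}" if "t \<subseteq> f" "card t = ?D" for t
        using small that by simp
    qed
  qed
  then obtain c where c: "c \<in> \<Inter>f"
    by blast
  show ?thesis
  proof (rule that, rule ccontr)
    fix a b
    let ?T = "{i \<in> S. a \<bullet> x i \<le> b}"
    assume ab: "a \<bullet> c \<le> b" and "\<not> \<tau> S \<le> ?D * \<tau> ?T"
    moreover have "S - (S - ?T) = ?T"
      by auto
    ultimately have "S - ?T \<in> \<G>"
      by (simp add: \<G>_def)
    then have "c \<in> convex hull (x ` (S - ?T))"
      using c by (auto simp: f_def)
    also have "\<dots> \<subseteq> {y. a \<bullet> y > b}"
      by (rule hull_minimal) (auto simp: convex_halfspace_gt)
    finally show False
      using ab by simp
  qed
qed

section \<open>Transversals and strict separation\<close>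

lemma hyperplane_through_few_points:
  fixes S :: "'a::euclidean_space set"
  assumes "finite S" "card S \<le> DIM('a)"
  obtains a b where "a \<noteq> 0" "S \<subseteq> {x. a \<bullet> x = b}"
proof -
  have "aff_dim S < int DIM('a)"
    using aff_dim_le_card[OF assms(1)] assms(2) by linarith
  then show ?thesis
    using aff_lowdim_subset_hyperplane that by metis
qed

text \<open>A transversal \<open>h\<close> would contain one point of each of d + 1 sets. These
  points are affinely dependent, so they have a Radon partition, which contradicts strict separation
  for the corresponding sign pattern.\<close>

lemma no_transversal_if_separated:
  fixes K :: "'j \<Rightarrow> 'a::euclidean_space set"
  assumes J: "card J = DIM('a) + 1"
    and sep: "\<And>A B. A \<inter> B = {} \<Longrightarrow> A \<union> B = J \<Longrightarrow>
      \<exists>a b. (\<forall>j\<in>A. K j \<subseteq> {x. a \<bullet> x > b}) \<and> (\<forall>j\<in>B. K j \<subseteq> {x. a \<bullet> x < b})"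
    and h: "hyperplane h"
  shows "\<exists>j\<in>J. K j \<inter> h = {}"
proof (rule ccontr)
  assume "\<not> ?thesis"
  then have "\<forall>j\<in>J. \<exists>x. x \<in> K j \<and> x \<in> h"
    by blast
  then obtain z where z: "\<And>j. j \<in> J \<Longrightarrow> z j \<in> K j" "\<And>j. j \<in> J \<Longrightarrow> z j \<in> h"
    by metis
  have "finite J"
    using J by (intro card_ge_0_finite) simp
  \<comment> \<open>Separating \<open>j\<close> from all other indices shows that the chosen points
    are distinct, so there really are d + 1 of them.\<close>
  have "inj_on z J"
  proof (rule inj_onI, rule ccontr)
    fix i j assume ij: "i \<in> J" "j \<in> J" "z i = z j" "i \<noteq> j"
    obtain a b where "\<forall>j\<in>J - {j}. K j \<subseteq> {x. a \<bullet> x > b}" "\<forall>j\<in>{j}. K j \<subseteq> {x. a \<bullet> x < b}"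
      using sep[of "J - {j}" "{j}"] ij by blast
    then have "a \<bullet> z i > b" "a \<bullet> z j < b"
      using z(1) ij by blast+
    with ij(3) show False by simp
  qed
  then have card: "card (z ` J) = DIM('a) + 1"
    using J by (simp add: card_image)
  obtain a b where "a \<noteq> 0" "h = {x. a \<bullet> x = b}"
    using h unfolding hyperplane_def by blast
  then have "aff_dim (z ` J) \<le> int DIM('a) - 1"
    using aff_dim_subset[of "z ` J" h] z(2) aff_dim_hyperplane[of a b] by auto
  then have "affine_dependent (z ` J)"
    using aff_dim_affine_independent[of "z ` J"] card by linarith
  then obtain U V where UV: "U \<subseteq> z ` J" "V \<subseteq> z ` J" "U \<inter> V = {}" "convex hull U \<inter> convex hull V \<noteq> {}"
    using Radon by metis
  \<comment> \<open>The two Radon parts need not exhaust the points; indices outside both parts join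
    the side of \<open>V\<close>, so that every index of \<open>J\<close> gets a sign.\<close>
  define A where "A = {j \<in> J. z j \<in> U}"
  obtain a b where ab: "\<forall>j\<in>A. K j \<subseteq> {x. a \<bullet> x > b}" "\<forall>j\<in>J - A. K j \<subseteq> {x. a \<bullet> x < b}"
    using sep[of A "J - A"] unfolding A_def by blast
  have "U \<subseteq> {x. a \<bullet> x > b}" "V \<subseteq> {x. a \<bullet> x < b}"
    using UV z(1) ab unfolding A_def by blast+
  then have "convex hull U \<subseteq> {x. a \<bullet> x > b}" "convex hull V \<subseteq> {x. a \<bullet> x < b}"
    by (auto intro!: hull_minimal simp: convex_halfspace_gt convex_halfspace_lt del: subsetI)
  with UV(4) show False by fastforce
qed

lemma convex_misses_hyperplane:
  fixes K :: "'a::euclidean_space set"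
  assumes "convex K" "K \<inter> {x. a \<bullet> x = b} = {}" "x \<in> K"
  shows "a \<bullet> x > b \<Longrightarrow> K \<subseteq> {x. a \<bullet> x > b}" "a \<bullet> x < b \<Longrightarrow> K \<subseteq> {x. a \<bullet> x < b}"
proof -
  have *: "a \<bullet> y > b \<or> b > a \<bullet> z" if "y \<in> K" "z \<in> K" for y z
    using connected_ivt_hyperplane[OF convex_connected[OF assms(1)] that, of a b] assms(2)
    by force
  show "K \<subseteq> {x. a \<bullet> x > b}" if "a \<bullet> x > b"
    using *[OF _ assms(3)] that by force
  show "K \<subseteq> {x. a \<bullet> x < b}" if "a \<bullet> x < b"
    using *[OF assms(3)] that by force
qed

section \<open>Piercing numbers\<close>

definition pierces :: "'a::euclidean_space set set \<Rightarrow> ('i \<Rightarrow> 'a set) \<Rightarrow> 'i set \<Rightarrow> bool" where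
  "pierces Q K S \<longleftrightarrow> finite Q \<and> (\<forall>h\<in>Q. hyperplane h) \<and> (\<forall>i\<in>S. \<exists>h\<in>Q. K i \<inter> h \<noteq> {})"

text \<open>The minimum is meaningful only if some finite set of hyperplanes pierces;
  \<open>optimal_piercing\<close> provides this for finite families of nonempty sets.\<close>

definition piercing_number :: "('i \<Rightarrow> 'a::euclidean_space set) \<Rightarrow> 'i set \<Rightarrow> nat" where
  "piercing_number K S = (LEAST n. \<exists>Q. pierces Q K S \<and> card Q = n)"

lemma piercing_number_le: "pierces Q K S \<Longrightarrow> piercing_number K S \<le> card Q"
  unfolding piercing_number_def by (rule Least_le) blast

lemma piercing_number_empty [simp]: "piercing_number K {} = 0"
  using piercing_number_le[of "{}" K "{}"] by (simp add: pierces_def)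

lemma piercing_number_le_1:
  assumes "hyperplane h" "\<And>i. i \<in> S \<Longrightarrow> K i \<inter> h \<noteq> {}"
  shows "piercing_number K S \<le> 1"
  using piercing_number_le[of "{h}" K S] assms by (simp add: pierces_def)

locale finite_convex_family =
  fixes I :: "'i set" and K :: "'i \<Rightarrow> 'a::euclidean_space set"
  assumes finite_I: "finite I"
    and convex_K: "i \<in> I \<Longrightarrow> convex (K i)"
    and nonempty_K: "i \<in> I \<Longrightarrow> K i \<noteq> {}"
begin

abbreviation "\<tau> \<equiv> piercing_number K"

lemma some_in_K: "i \<in> I \<Longrightarrow> (SOME y. y \<in> K i) \<in> K i"
  using nonempty_K by (simp add: some_in_eq)

text \<open>Parallel hyperplanes, one through a point of each set, form a finite piercing set, so
  the minimum is attained.\<close>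

lemma optimal_piercing:
  assumes "S \<subseteq> I"
  obtains Q where "pierces Q K S" "card Q = \<tau> S"
proof -
  obtain a :: 'a where "a \<noteq> 0"
    using nonzero_Basis nonempty_Basis by blast
  define Q where "Q = (\<lambda>i. {x. a \<bullet> x = a \<bullet> (SOME y. y \<in> K i)}) ` S"
  have "pierces Q K S"
    unfolding pierces_def
  proof (intro conjI ballI)
    show "finite Q"
      using assms finite_I finite_subset unfolding Q_def by blast
    show "hyperplane h" if "h \<in> Q" for h
      using that \<open>a \<noteq> 0\<close> unfolding Q_def hyperplane_def by auto
    show "\<exists>h\<in>Q. K i \<inter> h \<noteq> {}" if "i \<in> S" for i
    proof -
      have "(SOME y. y \<in> K i) \<in> K i"
        by (rule some_in_K) (use that assms in blast)
      then have "(SOME y. y \<in> K i) \<in> K i \<inter> {x. a \<bullet> x = a \<bullet> (SOME y. y \<in> K i)}"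
        by simp
      moreover have "{x. a \<bullet> x = a \<bullet> (SOME y. y \<in> K i)} \<in> Q"
        unfolding Q_def using that by (rule imageI)
      ultimately show ?thesis
        by (metis empty_iff)
    qed
  qed
  then have "\<exists>n Q. pierces Q K S \<and> card Q = n"
    by blast
  then have "\<exists>Q. pierces Q K S \<and> card Q = \<tau> S"
    unfolding piercing_number_def by (rule LeastI_ex)
  then show ?thesis
    using that by blast
qed

lemma piercing_number_Un:
  assumes "A \<subseteq> I" "B \<subseteq> I"
  shows "\<tau> (A \<union> B) \<le> \<tau> A + \<tau> B"
proof -
  obtain Q R where Q: "pierces Q K A" "card Q = \<tau> A" and R: "pierces R K B" "card R = \<tau> B"
    using optimal_piercing assms by metis
  have "pierces (Q \<union> R) K (A \<union> B)"
    using Q(1) R(1) unfolding pierces_def by blast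
  then have "\<tau> (A \<union> B) \<le> card (Q \<union> R)"
    by (rule piercing_number_le)
  also have "\<dots> \<le> \<tau> A + \<tau> B"
    using card_Un_le[of Q R] Q R by simp
  finally show ?thesis .
qed

definition above :: "'i set \<Rightarrow> 'a \<Rightarrow> real \<Rightarrow> 'i set" where
  "above S a b = {i \<in> S. K i \<subseteq> {x. a \<bullet> x > b}}"

definition below :: "'i set \<Rightarrow> 'a \<Rightarrow> real \<Rightarrow> 'i set" where
  "below S a b = {i \<in> S. K i \<subseteq> {x. a \<bullet> x < b}}"

lemma below_eq_above_uminus: "below S a b = above S (- a) (- b)"
  by (simp add: above_def below_def)

text \<open>By convexity, a set that misses the hyperplane lies strictly on one side; all sets that
  meet it are pierced by this single hyperplane.\<close>

lemma piercing_number_sides: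
  assumes "S \<subseteq> I" "a \<noteq> 0"
  shows "\<tau> S \<le> \<tau> (above S a b) + \<tau> (below S a b) + 1"
proof -
  let ?h = "{x. a \<bullet> x = b}"
  let ?M = "{i \<in> S. K i \<inter> ?h \<noteq> {}}"
  have "i \<in> above S a b \<union> below S a b \<union> ?M" if "i \<in> S" for i
  proof (cases "K i \<inter> ?h = {}")
    case True
    have "i \<in> I"
      using \<open>i \<in> S\<close> assms(1) by blast
    then obtain x where x: "x \<in> K i"
      using nonempty_K by blast
    then have "a \<bullet> x < b \<or> a \<bullet> x > b"
      using True by fastforce
    then have "K i \<subseteq> {x. a \<bullet> x < b} \<or> K i \<subseteq> {x. a \<bullet> x > b}"
      using convex_misses_hyperplane[OF convex_K[OF \<open>i \<in> I\<close>] True x] by blast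
    then show ?thesis
      using \<open>i \<in> S\<close> unfolding above_def below_def by blast
  qed (use that in blast)
  then have S: "S = (above S a b \<union> below S a b) \<union> ?M"
    unfolding above_def below_def by blast
  have "\<tau> S \<le> \<tau> (above S a b \<union> below S a b) + \<tau> ?M"
    by (subst S, rule piercing_number_Un) (use assms(1) in \<open>auto simp: above_def below_def\<close>)
  moreover have "\<tau> (above S a b \<union> below S a b) \<le> \<tau> (above S a b) + \<tau> (below S a b)"
    by (rule piercing_number_Un) (use assms(1) in \<open>auto simp: above_def below_def\<close>)
  moreover have "\<tau> ?M \<le> 1"
    by (rule piercing_number_le_1[of ?h]) (use assms(2) in \<open>auto simp: hyperplane_def\<close>)
  ultimately show ?thesis by linarith
qed

text \<open>The center is a \<open>\<tau>\<close>-centerpoint of one representative point per set. A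
  set whose representative lies in the closed lower half-space either lies strictly below the
  hyperplane or meets it, and all sets of the second kind together cost 1.\<close>

lemma piercing_center:
  assumes "S \<subseteq> I"
  obtains c where "\<And>a b. a \<noteq> 0 \<Longrightarrow> a \<bullet> c = b \<Longrightarrow> \<tau> S \<le> (DIM('a) + 1) * (\<tau> (above S a b) + 1)"
    "\<And>a b. a \<noteq> 0 \<Longrightarrow> a \<bullet> c = b \<Longrightarrow> \<tau> S \<le> (DIM('a) + 1) * (\<tau> (below S a b) + 1)"
proof -
  define x where "x = (\<lambda>i. SOME y. y \<in> K i)"
  have x: "x i \<in> K i" if "i \<in> S" for i
    unfolding x_def by (rule some_in_K) (use that assms in blast)
  obtain c where c: "\<And>a b. a \<bullet> c \<le> b \<Longrightarrow> \<tau> S \<le> (DIM('a) + 1) * \<tau> {i \<in> S. a \<bullet> x i \<le> b}"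
    by (rule subadditive_centerpoint[of S \<tau> x])
      (use assms finite_I finite_subset in \<open>auto intro!: piercing_number_Un\<close>)
  have below: "\<tau> S \<le> (DIM('a) + 1) * (\<tau> (below S a b) + 1)" if "a \<noteq> 0" "a \<bullet> c = b" for a b
  proof -
    let ?h = "{x. a \<bullet> x = b}"
    let ?T = "{i \<in> S. a \<bullet> x i \<le> b}"
    let ?M = "{i \<in> S. K i \<inter> ?h \<noteq> {}}"
    have "i \<in> below S a b" if i: "i \<in> S" "a \<bullet> x i \<le> b" "K i \<inter> ?h = {}" for i
    proof -
      have "a \<bullet> x i \<noteq> b"
        using i x by blast
      then show ?thesis
        using convex_misses_hyperplane(2)[OF _ i(3) x] i convex_K[of i] assms
        unfolding below_def by auto
    qed
    then have "?T = (?T \<inter> below S a b) \<union> (?T \<inter> ?M)"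
      by blast
    moreover have sub: "below S a b \<subseteq> I" "?M \<subseteq> I" "?T \<subseteq> I"
      using assms unfolding below_def by auto
    ultimately have "\<tau> ?T \<le> \<tau> (?T \<inter> below S a b) + \<tau> (?T \<inter> ?M)"
      using piercing_number_Un[of "?T \<inter> below S a b" "?T \<inter> ?M"] sub by (metis (lifting) le_infI2)
    moreover have "?T \<inter> below S a b = below S a b"
      using x unfolding below_def by fastforce
    moreover have "\<tau> (?T \<inter> ?M) \<le> 1"
      by (rule piercing_number_le_1[of ?h]) (use that in \<open>auto simp: hyperplane_def\<close>)
    ultimately have "\<tau> ?T \<le> \<tau> (below S a b) + 1"
      by simp
    then have "(DIM('a) + 1) * \<tau> ?T \<le> (DIM('a) + 1) * (\<tau> (below S a b) + 1)"
      by (rule mult_le_mono2)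
    with c[of a b] that show ?thesis
      by linarith
  qed
  moreover have "\<tau> S \<le> (DIM('a) + 1) * (\<tau> (above S a b) + 1)" if "a \<noteq> 0" "a \<bullet> c = b" for a b
    using below[of "- a" "- b"] that by (simp add: below_eq_above_uminus)
  ultimately show ?thesis
    using that by blast
qed

section \<open>Shrinking copies of the family until they are separated\<close>

text \<open>\<open>F j\<close> is what remains of the j-th copy of the family, and the pair is a
  sign pattern on the copies. One hyperplane must serve all members of these copies at once, so
  every choice of one member per copy inherits the separation.\<close>

definition separated :: "('j \<Rightarrow> 'i set) \<Rightarrow> 'j set \<times> 'j set \<Rightarrow> bool" where
  "separated F = (\<lambda>(A, B). \<exists>a b. (\<forall>j\<in>A. \<forall>i\<in>F j. K i \<subseteq> {x. a \<bullet> x > b}) \<and>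
     (\<forall>j\<in>B. \<forall>i\<in>F j. K i \<subseteq> {x. a \<bullet> x < b}))"

lemma separated_mono: "separated F AB \<Longrightarrow> (\<And>j. F' j \<subseteq> F j) \<Longrightarrow> separated F' AB"
  unfolding separated_def by (cases AB) (simp, meson subsetD)

lemma separated_swap: "separated F (A, B) \<Longrightarrow> separated F (B, A)"
proof -
  assume "separated F (A, B)"
  then obtain a b where ab: "\<forall>j\<in>A. \<forall>i\<in>F j. K i \<subseteq> {x. a \<bullet> x > b}" "\<forall>j\<in>B. \<forall>i\<in>F j. K i \<subseteq> {x. a \<bullet> x < b}"
    unfolding separated_def split by (elim exE conjE)
  show ?thesis
    unfolding separated_def split
    by (rule exI[of _ "- a"], rule exI[of _ "- b"]) (use ab in simp)
qed

text \<open>The hyperplane passes through centers of all copies in the pattern except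
  \<open>j0\<close>, so each of these d copies is large on both sides. Only the good side of
  \<open>j0\<close> is beyond control; if it is the wrong one, the two sides are exchanged for all
  copies.\<close>

lemma separate_step:
  assumes F: "\<And>j. F j \<subseteq> I"
    and AB: "A \<inter> B = {}" "card (A \<union> B) = DIM('a) + 1"
    and large: "\<And>j. j \<in> X \<Longrightarrow> (DIM('a) + 1) * (m + 1) \<le> \<tau> (F j)" "A \<union> B \<subseteq> X"
  obtains F' where "\<And>j. F' j \<subseteq> F j" "\<And>j. j \<in> X \<Longrightarrow> m \<le> \<tau> (F' j)" "separated F' (A, B)"
proof -
  let ?D = "DIM('a) + 1"
  obtain j0 where j0: "j0 \<in> A \<union> B"
    using AB(2) by (metis card.empty all_not_in_conv add_is_0 one_neq_zero)
  have fin: "finite (A \<union> B)"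
    using AB(2) by (intro card_ge_0_finite) simp
  have "\<exists>c. \<forall>a. a \<noteq> 0 \<longrightarrow> \<tau> (F j) \<le> ?D * (\<tau> (above (F j) a (a \<bullet> c)) + 1) \<and>
      \<tau> (F j) \<le> ?D * (\<tau> (below (F j) a (a \<bullet> c)) + 1)" for j
    by (rule piercing_center[OF F[of j]]) blast
  then obtain c where c: "\<And>j a. a \<noteq> 0 \<Longrightarrow> \<tau> (F j) \<le> ?D * (\<tau> (above (F j) a (a \<bullet> c j)) + 1) \<and>
      \<tau> (F j) \<le> ?D * (\<tau> (below (F j) a (a \<bullet> c j)) + 1)"
    by metis
  have "card (c ` (A \<union> B - {j0})) \<le> DIM('a)"
    using card_image_le[of "A \<union> B - {j0}" c] fin AB(2) j0 by simp
  then obtain a b where a: "a \<noteq> 0" and h: "c ` (A \<union> B - {j0}) \<subseteq> {x. a \<bullet> x = b}"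
    using hyperplane_through_few_points[of "c ` (A \<union> B - {j0})"] fin by blast
  have both: "m \<le> \<tau> (above (F j) a b)" "m \<le> \<tau> (below (F j) a b)" if j: "j \<in> A \<union> B - {j0}" for j
  proof -
    have "a \<bullet> c j = b"
      using h j by blast
    moreover have "?D * (m + 1) \<le> \<tau> (F j)"
      using large j by blast
    ultimately have "?D * (m + 1) \<le> ?D * (\<tau> (above (F j) a b) + 1)" "?D * (m + 1) \<le> ?D * (\<tau> (below (F j) a b) + 1)"
      using c[OF a, of j] by (auto simp only: intro: order_trans)
    then show "m \<le> \<tau> (above (F j) a b)" "m \<le> \<tau> (below (F j) a b)"
      unfolding mult_le_cancel1 by simp_all
  qed
  have trivial: "m \<le> \<tau> (F j)" if "j \<in> X" for j
    using large(1)[OF that] by simp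
  \<comment> \<open>As d + 1 is at least 2, \<open>\<tau> (F j0)\<close> is at least 2 (m + 1). The
    sets meeting the hyperplane take at most 1 of this, so one side keeps at least m.\<close>
  have one: "m \<le> \<tau> (above (F j0) a b) \<or> m \<le> \<tau> (below (F j0) a b)"
  proof -
    have "2 * (m + 1) \<le> ?D * (m + 1)"
      by (intro mult_le_mono1) (simp add: Suc_le_eq)
    then show ?thesis
      using piercing_number_sides[OF F a, of j0 b] large(1)[of j0] large(2) j0
      by (auto simp del: mult_Suc)
  qed
  define G where "G = (\<lambda>A B j. if j \<in> A then above (F j) a b else if j \<in> B then below (F j) a b else F j)"
  have G_sub: "G A' B' j \<subseteq> F j" for A' B' j
    by (auto simp: G_def above_def below_def)
  have G_sep: "separated (G A' B') (A', B')" if "A' \<inter> B' = {}" for A' B'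
    unfolding separated_def split
  proof (intro exI conjI ballI)
    show "K i \<subseteq> {x. a \<bullet> x > b}" if "j \<in> A'" "i \<in> G A' B' j" for i j
      using that by (simp add: G_def above_def)
    show "K i \<subseteq> {x. a \<bullet> x < b}" if "j \<in> B'" "i \<in> G A' B' j" for i j
      using that \<open>A' \<inter> B' = {}\<close> by (auto simp: G_def below_def split: if_splits)
  qed
  have G_large: "m \<le> \<tau> (G A' B' j)"
    if "A' \<union> B' = A \<union> B" "j0 \<in> A' \<Longrightarrow> m \<le> \<tau> (above (F j0) a b)"
      "j0 \<in> B' \<Longrightarrow> m \<le> \<tau> (below (F j0) a b)" "j \<in> X" for A' B' j
    using that both[of j] trivial[of j] unfolding G_def by (cases "j = j0") auto
  show ?thesis
  proof (cases "(j0 \<in> A \<longrightarrow> m \<le> \<tau> (above (F j0) a b)) \<and> (j0 \<in> B \<longrightarrow> m \<le> \<tau> (below (F j0) a b))")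
    case True
    show ?thesis
      by (rule that[of "G A B"]) (use True AB(1) G_sub G_sep G_large in auto)
  next
    \<comment> \<open>\<open>j0\<close> is large only on the side opposite to the prescribed one.
      The restriction realises the reversed pattern, and negating the normal vector turns it into
      the required one.\<close>
    case False
    have "m \<le> \<tau> (G B A j)" if "j \<in> X" for j
      by (rule G_large) (use False one AB(1) that in auto)
    then show ?thesis
      using that[of "G B A"] G_sub G_sep[of B A] AB(1) separated_swap by blast
  qed
qed

text \<open>Patterns are treated one after another. Each costs one application of the map from m to
  (d + 1) (m + 1), and later shrinking preserves the separations already achieved.\<close>

lemma separate_all:
  assumes "finite \<C>" and "\<And>A B. (A, B) \<in> \<C> \<Longrightarrow> A \<inter> B = {} \<and> card (A \<union> B) = DIM('a) + 1 \<and> A \<union> B \<subseteq> X"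
    and "\<And>j. F j \<subseteq> I"
    and "\<And>j. j \<in> X \<Longrightarrow> ((\<lambda>m. (DIM('a) + 1) * (m + 1)) ^^ card \<C>) m \<le> \<tau> (F j)"
  obtains F' where "\<And>j. F' j \<subseteq> F j" "\<And>j. j \<in> X \<Longrightarrow> m \<le> \<tau> (F' j)" "\<And>AB. AB \<in> \<C> \<Longrightarrow> separated F' AB"
  using assms
proof (induction \<C> arbitrary: F thesis rule: finite_induct)
  case empty
  show ?case by (rule empty.prems(1)[of F]) (use empty.prems in auto)
next
  case (insert AB \<C>)
  obtain A B where AB: "AB = (A, B)" by fastforce
  obtain F1 where F1: "\<And>j. F1 j \<subseteq> F j" "separated F1 AB"
    "\<And>j. j \<in> X \<Longrightarrow> ((\<lambda>m. (DIM('a) + 1) * (m + 1)) ^^ card \<C>) m \<le> \<tau> (F1 j)"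
  proof (rule separate_step[of F A B X "((\<lambda>m. (DIM('a) + 1) * (m + 1)) ^^ card \<C>) m"])
    show "A \<inter> B = {}" "card (A \<union> B) = DIM('a) + 1" "A \<union> B \<subseteq> X"
      using insert.prems(2)[of A B] AB by auto
    show "F j \<subseteq> I" for j
      by (rule insert.prems)
    show "(DIM('a) + 1) * (((\<lambda>m. (DIM('a) + 1) * (m + 1)) ^^ card \<C>) m + 1) \<le> \<tau> (F j)" if "j \<in> X" for j
      using insert.prems(4)[OF that] insert.hyps by simp
  qed (use that AB in blast)
  obtain F2 where F2: "\<And>j. F2 j \<subseteq> F1 j" "\<And>j. j \<in> X \<Longrightarrow> m \<le> \<tau> (F2 j)" "\<And>AB. AB \<in> \<C> \<Longrightarrow> separated F2 AB"
  proof (rule insert.IH[of F1])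
    show "F1 j \<subseteq> I" for j
      using F1(1) insert.prems(3) by (meson subset_trans)
    show "A \<inter> B = {} \<and> card (A \<union> B) = DIM('a) + 1 \<and> A \<union> B \<subseteq> X" if "(A, B) \<in> \<C>" for A B
      by (rule insert.prems(2)) (use that in simp)
  qed (use F1(3) in auto)
  have "separated F2 AB"
    using separated_mono F1(2) F2(1) by metis
  then show ?case
    using insert.prems(1)[of F2] F1(1) F2 by (metis insertE subset_trans)
qed

end

section \<open>A (p,q)-theorem for hyperplane transversals of convex sets\<close>

definition split_pairs :: "nat \<Rightarrow> nat \<Rightarrow> (nat set \<times> nat set) set" where
  "split_pairs k p = {(A, B). A \<union> B \<subseteq> {..<p} \<and> A \<inter> B = {} \<and> card (A \<union> B) = k}"

text \<open>Undoes the loss of \<open>separate_step\<close> once per sign pattern, ending at 1: a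
  copy that starts with this piercing number is still nonempty after all patterns are
  treated.\<close>

definition piercing_bound :: "nat \<Rightarrow> nat \<Rightarrow> nat" where
  "piercing_bound k p = ((\<lambda>m. k * (m + 1)) ^^ card (split_pairs k p)) 1"

lemma finite_split_pairs: "finite (split_pairs k p)"
  by (rule finite_subset[of _ "Pow {..<p} \<times> Pow {..<p}"]) (auto simp: split_pairs_def)

text \<open>If the piercing number reached the bound, p copies of \<open>I\<close> could be shrunk
  to nonempty subfamilies separated in every pattern. One index from each gives p members, no d + 1
  of which have a common transversal.\<close>

theorem (in finite_convex_family) hyperplane_pq:
  assumes p: "DIM('a) + 1 \<le> p"
    and pq: "\<And>J. J \<subseteq> I \<Longrightarrow> card J = p \<Longrightarrow>
      \<exists>L\<subseteq>J. DIM('a) + 1 \<le> card L \<and> (\<exists>h. hyperplane h \<and> (\<forall>i\<in>L. K i \<inter> h \<noteq> {}))"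
  shows "piercing_number K I < piercing_bound (DIM('a) + 1) p"
proof (rule ccontr)
  let ?D = "DIM('a) + 1"
  assume "\<not> ?thesis"
  then have large: "piercing_bound ?D p \<le> \<tau> I"
    by simp
  obtain F :: "nat \<Rightarrow> 'i set" where
    F: "\<And>j. F j \<subseteq> I" "\<And>j. j \<in> {..<p} \<Longrightarrow> 1 \<le> \<tau> (F j)" "\<And>AB. AB \<in> split_pairs ?D p \<Longrightarrow> separated F AB"
  proof (rule separate_all[of "split_pairs ?D p" "{..<p}" "\<lambda>_. I" 1])
    show "finite (split_pairs ?D p)"
      by (rule finite_split_pairs)
    show "A \<inter> B = {} \<and> card (A \<union> B) = ?D \<and> A \<union> B \<subseteq> {..<p}" if "(A, B) \<in> split_pairs ?D p" for A B
      using that by (simp add: split_pairs_def)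
  qed (use large in \<open>auto simp only: piercing_bound_def\<close>)
  have "\<exists>i. i \<in> F j" if "j < p" for j
  proof (rule ccontr)
    assume "\<not> ?thesis"
    then have "F j = {}"
      by blast
    with F(2)[of j] that show False
      by simp
  qed
  then obtain k where k: "\<And>j. j < p \<Longrightarrow> k j \<in> F j"
    by metis
  have sep: "\<exists>a b. (\<forall>j\<in>A. K (k j) \<subseteq> {x. a \<bullet> x > b}) \<and> (\<forall>j\<in>B. K (k j) \<subseteq> {x. a \<bullet> x < b})"
    if AB: "(A, B) \<in> split_pairs ?D p" for A B
  proof -
    have kF: "k j \<in> F j" if "j \<in> A \<union> B" for j
      by (rule k) (use AB that in \<open>auto simp: split_pairs_def\<close>)
    obtain a b where "\<forall>j\<in>A. \<forall>i\<in>F j. K i \<subseteq> {x. a \<bullet> x > b}" "\<forall>j\<in>B. \<forall>i\<in>F j. K i \<subseteq> {x. a \<bullet> x < b}"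
      using F(3)[OF AB] unfolding separated_def split by (elim exE conjE)
    then show ?thesis
      using kF by (intro exI[of _ a] exI[of _ b]) simp
  qed
  \<comment> \<open>All copies come from the same family, so the chosen indices might coincide,
    while \<open>pq\<close> speaks of p distinct ones. A repeated index would put one nonempty set
    strictly on both sides of a hyperplane.\<close>
  have "inj_on k {..<p}"
  proof (rule inj_onI, rule ccontr)
    fix i j assume ij: "i \<in> {..<p}" "j \<in> {..<p}" "k i = k j" "i \<noteq> j"
    obtain S where S: "{i, j} \<subseteq> S" "S \<subseteq> {..<p}" "card S = ?D"
      using exists_subset_between[of "{i, j}" ?D "{..<p}"] ij p by (auto simp: Suc_le_eq)
    then have "(S - {j}, {j}) \<in> split_pairs ?D p"
      by (auto simp: split_pairs_def insert_absorb)
    from sep[OF this] obtain a b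
      where ab: "\<forall>l\<in>S - {j}. K (k l) \<subseteq> {x. a \<bullet> x > b}" "\<forall>l\<in>{j}. K (k l) \<subseteq> {x. a \<bullet> x < b}"
      by (elim exE conjE)
    have "k j \<in> I"
      using k[of j] F(1) ij(2) by blast
    then obtain x where x: "x \<in> K (k j)"
      using nonempty_K by blast
    have "i \<in> S - {j}"
      using S(1) ij(4) by blast
    then have "K (k j) \<subseteq> {x. a \<bullet> x > b}"
      using ab(1) ij(3) by metis
    then show False
      using x ab(2) by force
  qed
  then have "card (k ` {..<p}) = p"
    by (simp add: card_image)
  moreover have "k ` {..<p} \<subseteq> I"
    using k F(1) by blast
  ultimately obtain L h where L: "L \<subseteq> k ` {..<p}" "?D \<le> card L" and h: "hyperplane h" "\<forall>i\<in>L. K i \<inter> h \<noteq> {}"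
    using pq by meson
  obtain L' where L': "L' \<subseteq> L" "card L' = ?D"
    using obtain_subset_with_card_n[OF L(2)] by metis
  then obtain J where J: "J \<subseteq> {..<p}" "inj_on k J" "L' = k ` J"
    using L(1) subset_image_inj[of L' k "{..<p}"] by blast
  have "card J = ?D"
    using J L'(2) by (simp add: card_image)
  have "\<exists>j\<in>J. K (k j) \<inter> h = {}"
    by (rule no_transversal_if_separated[OF \<open>card J = ?D\<close> sep h(1)])
      (use J(1) \<open>card J = ?D\<close> in \<open>auto simp: split_pairs_def\<close>)
  then show False
    using h(2) J(3) L'(1) by blast
qed

section \<open>Points of large depth\<close>

definition depth_region :: "real \<Rightarrow> 'a::euclidean_space set \<Rightarrow> 'a set" where
  "depth_region \<beta> P =
     {x. \<forall>a b. a \<noteq> 0 \<longrightarrow> a \<bullet> x \<le> b \<longrightarrow> \<beta> * card P \<le> card (P \<inter> {y. a \<bullet> y \<le> b})}"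

text \<open>A half-space that contains a convex combination of two points contains one of the
  two.\<close>

lemma convex_depth_region: "convex (depth_region \<beta> P)"
proof (rule convexI)
  fix x y u v assume xy: "x \<in> depth_region \<beta> P" "y \<in> depth_region \<beta> P"
    and uv: "0 \<le> u" "0 \<le> v" "u + v = (1::real)"
  have "a \<bullet> x \<le> b \<or> a \<bullet> y \<le> b" if "a \<bullet> (u *\<^sub>R x + v *\<^sub>R y) \<le> b" for a b
  proof (rule ccontr)
    assume "\<not> ?thesis"
    then have "u *\<^sub>R x + v *\<^sub>R y \<in> {z. a \<bullet> z > b}"
      by (intro convexD[OF convex_halfspace_gt]) (use uv in auto)
    with that show False by simp
  qed
  then show "u *\<^sub>R x + v *\<^sub>R y \<in> depth_region \<beta> P"
    using xy unfolding depth_region_def by blast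
qed

lemma point_centerpoint:
  fixes S :: "'a::euclidean_space set"
  assumes "finite S"
  obtains c where "\<And>a b. a \<bullet> c \<le> b \<Longrightarrow> card S / (DIM('a) + 1) \<le> card (S \<inter> {y. a \<bullet> y \<le> b})"
proof -
  obtain c where c: "\<And>a b. a \<bullet> c \<le> b \<Longrightarrow> card S \<le> (DIM('a) + 1) * card {i \<in> S. a \<bullet> i \<le> b}"
    by (rule subadditive_centerpoint[of S card "\<lambda>y. y"]) (use assms card_Un_le in auto)
  show ?thesis
  proof (rule that)
    fix a b assume "a \<bullet> c \<le> b"
    from c[OF this] have "real (card S) \<le> real ((DIM('a) + 1) * card {i \<in> S. a \<bullet> i \<le> b})"
      by (simp only: of_nat_le_iff)
    moreover have "{i \<in> S. a \<bullet> i \<le> b} = S \<inter> {y. a \<bullet> y \<le> b}"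
      by blast
    ultimately show "card S / (DIM('a) + 1) \<le> card (S \<inter> {y. a \<bullet> y \<le> b})"
      by (simp add: divide_le_eq algebra_simps)
  qed
qed

lemma depth_region_nonempty:
  fixes P :: "'a::euclidean_space set"
  assumes "finite P" "\<beta> \<le> 1 / (DIM('a) + 1)"
  shows "depth_region \<beta> P \<noteq> {}"
proof -
  obtain c where c: "\<And>a b. a \<bullet> c \<le> b \<Longrightarrow> card P / (DIM('a) + 1) \<le> card (P \<inter> {y. a \<bullet> y \<le> b})"
    using point_centerpoint[OF assms(1)] by metis
  have "\<beta> * card P \<le> card P / (DIM('a) + 1)"
    using mult_right_mono[OF assms(2), of "card P"] by simp
  then have "c \<in> depth_region \<beta> P"
    using c unfolding depth_region_def by (auto intro: order_trans)
  then show ?thesis by blast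
qed

text \<open>A point of \<open>h\<close> lies in both closed half-spaces of \<open>h\<close>, so its
  depth bounds both counts from below.\<close>

lemma split_by_if_meets_depth_region:
  assumes "hyperplane h" "depth_region \<beta> P \<inter> h \<noteq> {}"
  shows "split_by \<beta> P h"
  using assms unfolding split_by_def closed_halfspaces_def depth_region_def by auto

text \<open>Each closed half-space of \<open>h\<close> holds a part \<open>S\<close> with at least
  \<open>\<alpha> * card P\<close> points. A centerpoint of \<open>S\<close> is deep enough in
  \<open>P\<close> and lies in the same half-space. This gives points of the region on both sides of
  \<open>h\<close>, and by convexity one on \<open>h\<close>.\<close>

lemma meets_depth_region_if_split_by:
  fixes P :: "'a::euclidean_space set"
  assumes P: "finite P" and "\<alpha> > 0" and split: "split_by \<alpha> P h"
  shows "depth_region (\<alpha> / (DIM('a) + 1)) P \<inter> h \<noteq> {}"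
proof -
  obtain a b where a: "a \<noteq> 0" and h: "h = {x. a \<bullet> x = b}"
    using split unfolding split_by_def hyperplane_def by blast
  have side: "\<exists>c \<in> depth_region (\<alpha> / (DIM('a) + 1)) P. a' \<bullet> c \<le> b'"
    if a': "a' \<noteq> 0" "h = {x. a' \<bullet> x = b'}" for a' b'
  proof (cases "P = {}")
    \<comment> \<open>For empty \<open>P\<close> the region is the whole space, and a centerpoint of
      the empty part could lie anywhere; a point of \<open>h\<close> itself is taken
      instead.\<close>
    case True
    have "a' \<bullet> ((b' / (a' \<bullet> a')) *\<^sub>R a') = b'"
      using a' by simp
    with True show ?thesis
      by (intro bexI[of _ "(b' / (a' \<bullet> a')) *\<^sub>R a'"]) (simp_all add: depth_region_def)
  next
    case False
    define S where "S = P \<inter> {x. a' \<bullet> x \<le> b'}"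
    have "{x. a' \<bullet> x \<le> b'} \<in> closed_halfspaces h"
      using a' unfolding closed_halfspaces_def by blast
    then have S: "\<alpha> * card P \<le> card S"
      using split unfolding split_by_def S_def by blast
    have finS: "finite S"
      using P by (simp add: S_def)
    obtain c where c: "\<And>a b. a \<bullet> c \<le> b \<Longrightarrow> card S / (DIM('a) + 1) \<le> card (S \<inter> {y. a \<bullet> y \<le> b})"
      using point_centerpoint[OF finS] by metis
    have "c \<in> depth_region (\<alpha> / (DIM('a) + 1)) P"
      unfolding depth_region_def
    proof (intro CollectI allI impI)
      fix u v assume "u \<bullet> c \<le> v"
      have "\<alpha> / (DIM('a) + 1) * card P \<le> card S / (DIM('a) + 1)"
        using divide_right_mono[OF S, of "DIM('a) + 1"] by simp
      also have "\<dots> \<le> card (S \<inter> {y. u \<bullet> y \<le> v})"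
        by (rule c) fact
      also have "\<dots> \<le> card (P \<inter> {y. u \<bullet> y \<le> v})"
        using P by (auto intro!: card_mono simp: S_def)
      finally show "\<alpha> / (DIM('a) + 1) * card P \<le> card (P \<inter> {y. u \<bullet> y \<le> v})" .
    qed
    moreover have "a' \<bullet> c \<le> b'"
    \<comment> \<open>If \<open>c\<close> were outside the half-space, the opposite half-space
      bounded at \<open>c\<close> would contain no point of \<open>S\<close>, although the
      centerpoint property demands a positive share of \<open>S\<close>.\<close>
    proof (rule ccontr)
      assume "\<not> ?thesis"
      then have "S \<inter> {y. - a' \<bullet> y \<le> - (a' \<bullet> c)} = {}"
        by (auto simp: S_def)
      then have "card S = 0"
        using c[of "- a'" "- (a' \<bullet> c)"] by (simp add: divide_le_0_iff)
      moreover have "\<alpha> * card P > 0"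
        using False P \<open>\<alpha> > 0\<close> by (simp add: card_gt_0_iff)
      ultimately show False
        using S by simp
    qed
    ultimately show ?thesis by blast
  qed
  obtain c1 where c1: "c1 \<in> depth_region (\<alpha> / (DIM('a) + 1)) P" "a \<bullet> c1 \<le> b"
    using side[OF a h] by blast
  obtain c2 where c2: "c2 \<in> depth_region (\<alpha> / (DIM('a) + 1)) P" "b \<le> a \<bullet> c2"
    using side[of "- a" "- b"] a h by auto
  show ?thesis
    using connected_ivt_hyperplane[OF convex_connected[OF convex_depth_region] c1(1) c2(1) c1(2) c2(2)] h
    by blast
qed

text \<open>\<open>C\<close> and \<open>\<beta>\<close> are chosen before all parameters and the
  family, and the dimension is fixed by the type \<open>'d\<close>, so they depend only on what
  their arguments show. With \<open>\<beta> \<alpha>\<close> = \<open>\<alpha>\<close> / (d + 1),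
  depth regions are nonempty, every \<open>\<alpha>\<close>-splitting hyperplane meets them, and
  every hyperplane meeting one \<open>\<beta>\<close>-splits its point set.\<close>

theorem theorem1p3:
  "\<exists>(C :: nat \<Rightarrow> nat \<Rightarrow> nat) (\<beta> :: real \<Rightarrow> real).
     \<forall>\<alpha> p q. 0 < \<alpha> \<and> \<alpha> \<le> 1/2 \<and> q \<le> p \<and> CARD('d::finite) + 1 \<le> q \<longrightarrow>
       0 < \<beta> \<alpha> \<and> \<beta> \<alpha> < \<alpha> \<and>
       (\<forall>n (P :: nat \<Rightarrow> (real ^ 'd) set).
          p \<le> n \<and> (\<forall>i\<in>{1..n}. finite (P i)) \<and> pq_property p q \<alpha> {1..n} P \<longrightarrow>
          (\<exists>Q. finite Q \<and> card Q \<le> C p q \<and> (\<forall>h\<in>Q. hyperplane h) \<and>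
               family_split_by (\<beta> \<alpha>) {1..n} P Q))"
proof (intro exI[of _ "\<lambda>p q. piercing_bound (CARD('d) + 1) p"] exI[of _ "\<lambda>\<alpha>. \<alpha> / (CARD('d) + 1)"]
    allI impI conjI; elim conjE)
  fix \<alpha> :: real and p q n and P :: "nat \<Rightarrow> (real ^ 'd) set"
  assume \<alpha>: "0 < \<alpha>" "\<alpha> \<le> 1/2"
  then show "0 < \<alpha> / (CARD('d) + 1)" "\<alpha> / (CARD('d) + 1) < \<alpha>"
    by (simp_all add: divide_less_eq)
  assume pq: "q \<le> p" "CARD('d) + 1 \<le> q" and fin: "\<forall>i\<in>{1..n}. finite (P i)"
    and PQ: "pq_property p q \<alpha> {1..n} P"
  define K where "K = (\<lambda>i. depth_region (\<alpha> / (CARD('d) + 1)) (P i))"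
  interpret finite_convex_family "{1..n}" K
  proof
    have "\<alpha> / (CARD('d) + 1) \<le> 1 / (DIM(real ^ 'd) + 1)"
      using \<alpha> by (simp add: divide_right_mono)
    then show "K i \<noteq> {}" if "i \<in> {1..n}" for i
      unfolding K_def by (intro depth_region_nonempty) (use fin that in auto)
  qed (simp_all add: K_def convex_depth_region)
  have "piercing_number K {1..n} < piercing_bound (DIM(real ^ 'd) + 1) p"
  proof (rule hyperplane_pq)
    show "DIM(real ^ 'd) + 1 \<le> p"
      using pq by simp
    fix J assume J: "J \<subseteq> {1..n}" "card J = p"
    from PQ[unfolded pq_property_def, rule_format, OF this]
    obtain L h where L: "L \<subseteq> J" "card L = q" "hyperplane h" "\<forall>i\<in>L. split_by \<alpha> (P i) h"
      by blast
    have "K i \<inter> h \<noteq> {}" if "i \<in> L" for i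
    proof -
      have "finite (P i)"
        using that L(1) J(1) fin by blast
      then show ?thesis
        using meets_depth_region_if_split_by[of "P i" \<alpha> h] that L(4) \<alpha>(1) by (simp add: K_def)
    qed
    then show "\<exists>L\<subseteq>J. DIM(real ^ 'd) + 1 \<le> card L \<and> (\<exists>h. hyperplane h \<and> (\<forall>i\<in>L. K i \<inter> h \<noteq> {}))"
      using L pq(2) by auto
  qed
  moreover obtain Q where Q: "pierces Q K {1..n}" "card Q = piercing_number K {1..n}"
    using optimal_piercing by blast
  moreover have "family_split_by (\<alpha> / (CARD('d) + 1)) {1..n} P Q"
    using Q(1) split_by_if_meets_depth_region unfolding family_split_by_def pierces_def K_def by metis
  ultimately show "\<exists>Q. finite Q \<and> card Q \<le> piercing_bound (CARD('d) + 1) p \<and> (\<forall>h\<in>Q. hyperplane h) \<and>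
      family_split_by (\<alpha> / (CARD('d) + 1)) {1..n} P Q"
    unfolding pierces_def by (intro exI[of _ Q]) auto
qed

end
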